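(* Assume that: (a) $\omega=\mathrm{cf}(\mu)<\mu<2^{\omega}$; (b) $(\mu_n:n<\omega)$ is a sequence of regular cardinals with $\mu=\bigcup_{n<\omega}\mu_n$, and $J$ is an ideal on $\omega$ containing all bounded subsets of $\omega$; (c) $\lambda={\rm tcf}(\prod_{n<\omega}\mu_n,J)$ and $(f_\alpha:\alpha<\lambda)$ is a scale witnessing this; (d) $\mu\leq\nu<\lambda$; (e) for every $A\in[\lambda]^{\aleph_1}$, $|\{f_\alpha(n):\alpha\in A,n<\omega\}|=\aleph_1$. Then $\mathfrak{gp}\neq\nu$.
   Context: $f<_J g$ iff $\{n:f(n)\geq g(n)\}\in J$. ${\rm tcf}(\prod_n\mu_n,J)=\lambda$ witnessed by the scale $(f_\alpha:\alpha<\lambda)$ means each $f_\alpha\in\prod_n\mu_n$, the sequence is $<_J$-increasing, and it is cofinal (every $g\in\prod_n\mu_n$ satisfies $g<_J f_\alpha$ for some $\alpha$). $\mathfrak{gp}$ is the minimal cardinal $\kappa$ such that every family $\{C_\alpha:\alpha<\kappa^+\}$ of club subsets of $\omega_1$ contains a subfamily $\{C_{\alpha_\beta}:\beta<\omega_1\}$ (distinct indices) whose intersection is a club of $\omega_1$. *)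

theory Defs
  imports Main
begin

unbundle cardinal_syntax

text \<open>
  Cardinals are the wellorder relations of the library (\<^const>\<open>card_order_on\<close>), equality and
  comparison of cardinals being \<open>=o\<close>, \<open>\<le>o\<close>, \<open><o\<close>; the ordinals below a cardinal are the elements
  of its field.  The first uncountable cardinal is the successor of \<^const>\<open>natLeq\<close>.
\<close>

abbreviation omega1 :: "nat set rel" where
  "omega1 \<equiv> cardSuc natLeq"


text \<open>
  The library's \<^const>\<open>cofinal\<close> asks for strictly larger elements, so this is the usual cofinality
  only for orders without a largest element, in particular for infinite cardinals.
\<close>

definition has_cofinality :: "'a rel \<Rightarrow> 'b rel \<Rightarrow> bool" where
  "has_cofinality r \<kappa> \<longleftrightarrow> Card_order \<kappa> \<and>
     (\<exists>K \<subseteq> Field r. cofinal K r \<and> |K| =o \<kappa>) \<and>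
     (\<forall>K \<subseteq> Field r. cofinal K r \<longrightarrow> \<kappa> \<le>o |K| )"


text \<open>Ideals are proper.\<close>

definition ideal_on_nat :: "nat set set \<Rightarrow> bool" where
  "ideal_on_nat J \<longleftrightarrow> {} \<in> J \<and> UNIV \<notin> J \<and>
     (\<forall>X \<in> J. \<forall>Y. Y \<subseteq> X \<longrightarrow> Y \<in> J) \<and> (\<forall>X \<in> J. \<forall>Y \<in> J. X \<union> Y \<in> J)"


text \<open>
  \<open>m n\<close> is the \<open>n\<close>-th factor of the product, so \<open>(g n, f n) \<in> m n\<close> reads \<open>g(n) \<le> f(n)\<close>.
\<close>

definition less_mod :: "nat set set \<Rightarrow> (nat \<Rightarrow> 'a rel) \<Rightarrow> (nat \<Rightarrow> 'a) \<Rightarrow> (nat \<Rightarrow> 'a) \<Rightarrow> bool" where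
  "less_mod J m f g \<longleftrightarrow> {n. (g n, f n) \<in> m n} \<in> J"

definition in_product :: "(nat \<Rightarrow> 'a rel) \<Rightarrow> (nat \<Rightarrow> 'a) \<Rightarrow> bool" where
  "in_product m g \<longleftrightarrow> (\<forall>n. g n \<in> Field (m n))"

definition tcf_witnessed_by ::
    "(nat \<Rightarrow> 'a rel) \<Rightarrow> nat set set \<Rightarrow> 'l rel \<Rightarrow> ('l \<Rightarrow> nat \<Rightarrow> 'a) \<Rightarrow> bool" where
  "tcf_witnessed_by m J lam f \<longleftrightarrow> Card_order lam \<and>
     (\<forall>\<alpha> \<in> Field lam. in_product m (f \<alpha>)) \<and>
     (\<forall>\<alpha> \<beta>. (\<alpha>, \<beta>) \<in> lam \<and> \<alpha> \<noteq> \<beta> \<longrightarrow> less_mod J m (f \<alpha>) (f \<beta>)) \<and>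
     (\<forall>g. in_product m g \<longrightarrow> (\<exists>\<alpha> \<in> Field lam. less_mod J m g (f \<alpha>)))"


text \<open>
  In the closure condition the hypotheses on \<open>\<delta>\<close> force it to be a nonzero limit point of \<open>C\<close>.
\<close>

definition club :: "'a rel \<Rightarrow> 'a set \<Rightarrow> bool" where
  "club r C \<longleftrightarrow> C \<subseteq> Field r \<and> cofinal C r \<and>
     (\<forall>\<delta> \<in> Field r. underS r \<delta> \<noteq> {} \<and>
        (\<forall>\<beta> \<in> underS r \<delta>. \<exists>\<gamma> \<in> C \<inter> underS r \<delta>. \<beta> \<noteq> \<gamma> \<and> (\<beta>, \<gamma>) \<in> r)
        \<longrightarrow> \<delta> \<in> C)"

definition gp_property :: "'a rel \<Rightarrow> bool" where
  "gp_property \<kappa> \<longleftrightarrow>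
     (\<forall>C :: 'a set \<Rightarrow> nat set set.
        (\<forall>\<alpha> \<in> Field (cardSuc \<kappa>). club omega1 (C \<alpha>)) \<longrightarrow>
        (\<exists>a. inj_on a (Field omega1) \<and> a ` Field omega1 \<subseteq> Field (cardSuc \<kappa>) \<and>
           club omega1 (\<Inter>\<beta> \<in> Field omega1. C (a \<beta>))))"

text \<open>
  The type \<^typ>\<open>nat set set\<close> has \<open>2\<close> to the \<open>2\<^sup>\<omega>\<close> elements, enough to carry the least cardinal with
  the property; \<open>gp_least\<close> below shows that it is least among the cardinals on all types.
\<close>

definition gp :: "nat set set rel" where
  "gp = (SOME \<kappa>. Card_order \<kappa> \<and> gp_property \<kappa> \<and>
     (\<forall>\<kappa>' :: nat set set rel. Card_order \<kappa>' \<and> gp_property \<kappa>' \<longrightarrow> \<kappa> \<le>o \<kappa>'))"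

lemma gp_property_mono:
  fixes \<kappa> :: "'a rel" and \<kappa>' :: "'b rel"
  assumes "Card_order \<kappa>" "Card_order \<kappa>'" "\<kappa> \<le>o \<kappa>'" "gp_property \<kappa>"
  shows "gp_property \<kappa>'"
  unfolding gp_property_def
proof (intro allI impI)
  fix C :: "'b set \<Rightarrow> nat set set"
  assume C: "\<forall>\<alpha> \<in> Field (cardSuc \<kappa>'). club omega1 (C \<alpha>)"
  have "cardSuc \<kappa> \<le>o cardSuc \<kappa>'"
    using assms by (simp add: cardSuc_mono_ordLeq)
  then have "|Field (cardSuc \<kappa>)| \<le>o |Field (cardSuc \<kappa>')|"
    by (rule card_of_mono2)
  then obtain g where g: "inj_on g (Field (cardSuc \<kappa>))"
      "g ` Field (cardSuc \<kappa>) \<subseteq> Field (cardSuc \<kappa>')"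
    by (meson card_of_ordLeq)
  have "\<forall>\<alpha> \<in> Field (cardSuc \<kappa>). club omega1 ((C \<circ> g) \<alpha>)"
    using C g by auto
  then obtain a where a: "inj_on a (Field omega1)" "a ` Field omega1 \<subseteq> Field (cardSuc \<kappa>)"
      "club omega1 (\<Inter>\<beta> \<in> Field omega1. (C \<circ> g) (a \<beta>))"
    using assms(4)[unfolded gp_property_def, rule_format, of "C \<circ> g"] by auto
  have "inj_on (g \<circ> a) (Field omega1)"
    using a(1) g(1) a(2) by (meson comp_inj_on inj_on_subset)
  moreover have "(g \<circ> a) ` Field omega1 \<subseteq> Field (cardSuc \<kappa>')"
    using a(2) g(2) by fastforce
  moreover have "club omega1 (\<Inter>\<beta> \<in> Field omega1. C ((g \<circ> a) \<beta>))"
    using a(3) by simp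
  ultimately show "\<exists>a. inj_on a (Field omega1) \<and> a ` Field omega1 \<subseteq> Field (cardSuc \<kappa>') \<and>
      club omega1 (\<Inter>\<beta> \<in> Field omega1. C (a \<beta>))"
    by blast
qed

lemma gp_property_UNIV: "gp_property |UNIV :: nat set set set|"
  unfolding gp_property_def
proof (intro allI impI)
  let ?k = "|UNIV :: nat set set set|" and ?F = "Field (cardSuc |UNIV :: nat set set set| )"
  fix C :: "nat set set set \<Rightarrow> nat set set"
  assume C: "\<forall>\<alpha> \<in> ?F. club omega1 (C \<alpha>)"
  have inf: "infinite (UNIV :: nat set set set)"
    by (simp add: Finite_Set.finite_set)
  have "\<exists>D \<in> C ` ?F. \<not> |{\<alpha> \<in> ?F. C \<alpha> = D}| \<le>o natLeq"
  proof (rule ccontr)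
    assume "\<not> ?thesis"
    moreover have "natLeq \<le>o ?k"
      using infinite_iff_natLeq_ordLeq[of "UNIV :: nat set set set"] inf by (simp only: not_False_eq_True simp_thms)
    ultimately have le: "\<forall>D \<in> C ` ?F. |{\<alpha> \<in> ?F. C \<alpha> = D}| \<le>o ?k"
      by (meson ordLeq_transitive)
    have "|\<Union>D \<in> C ` ?F. {\<alpha> \<in> ?F. C \<alpha> = D}| \<le>o ?k"
      by (rule card_of_UNION_ordLeq_infinite[OF inf card_of_mono1[OF subset_UNIV] le])
    moreover have "(\<Union>D \<in> C ` ?F. {\<alpha> \<in> ?F. C \<alpha> = D}) = ?F"
      by auto
    ultimately have "|?F| \<le>o ?k"
      by simp
    moreover have "|?F| =o cardSuc ?k"
      by (intro card_of_Field_ordIso cardSuc_Card_order card_of_Card_order)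
    ultimately have "cardSuc ?k \<le>o ?k"
      by (rule ordIso_ordLeq_trans[OF ordIso_symmetric, rotated])
    then show False
      using not_ordLess_ordLeq[OF cardSuc_greater[OF card_of_Card_order]] by (rule notE[rotated])
  qed
  then obtain D where D: "D \<in> C ` ?F" "\<not> |{\<alpha> \<in> ?F. C \<alpha> = D}| \<le>o natLeq"
    by blast
  have "natLeq <o |{\<alpha> \<in> ?F. C \<alpha> = D}|"
    using D(2) not_ordLeq_iff_ordLess[OF natLeq_Well_order card_of_Well_order] by (rule iffD1[rotated])
  then have "omega1 \<le>o |{\<alpha> \<in> ?F. C \<alpha> = D}|"
    by (intro cardSuc_least natLeq_Card_order card_of_Card_order)
  moreover have o1: "|Field omega1| =o omega1"
    by (intro card_of_Field_ordIso cardSuc_Card_order natLeq_Card_order)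
  ultimately have "|Field omega1| \<le>o |{\<alpha> \<in> ?F. C \<alpha> = D}|"
    by (rule ordIso_ordLeq_trans[rotated])
  then obtain a where a: "inj_on a (Field omega1)" "a ` Field omega1 \<subseteq> {\<alpha> \<in> ?F. C \<alpha> = D}"
    by (meson card_of_ordLeq)
  have ne: "Field omega1 \<noteq> {}"
    by (rule Field_cardSuc_not_empty[OF natLeq_Card_order])
  have "C (a \<beta>) = D" if "\<beta> \<in> Field omega1" for \<beta>
    using a(2) that by blast
  with ne have eq: "(\<Inter>\<beta> \<in> Field omega1. C (a \<beta>)) = D"
    by (intro INF_eq_const)
  have "club omega1 D"
    using C D(1) by blast
  moreover have "a ` Field omega1 \<subseteq> ?F"
    using a(2) by blast
  ultimately show "\<exists>a. inj_on a (Field omega1) \<and> a ` Field omega1 \<subseteq> ?F \<and>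
      club omega1 (\<Inter>\<beta> \<in> Field omega1. C (a \<beta>))"
    using a(1) unfolding eq[symmetric] by (intro exI[of _ a] conjI)
qed

lemma gp_spec:
  "Card_order gp \<and> gp_property gp \<and>
     (\<forall>\<kappa>' :: nat set set rel. Card_order \<kappa>' \<and> gp_property \<kappa>' \<longrightarrow> gp \<le>o \<kappa>')"
  unfolding gp_def
proof (rule someI_ex)
  let ?R = "{\<kappa> :: nat set set rel. Card_order \<kappa> \<and> gp_property \<kappa>}"
  have "?R \<noteq> {}"
    using gp_property_UNIV card_of_Card_order by blast
  moreover have "\<forall>r \<in> ?R. Card_order r"
    by blast
  ultimately have "\<exists>r \<in> ?R. \<forall>r' \<in> ?R. r \<le>o r'"
    by (rule exists_minim_Card_order)
  then show "\<exists>\<kappa> :: nat set set rel. Card_order \<kappa> \<and> gp_property \<kappa> \<and>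
      (\<forall>\<kappa>' :: nat set set rel. Card_order \<kappa>' \<and> gp_property \<kappa>' \<longrightarrow> \<kappa> \<le>o \<kappa>')"
    by blast
qed

lemma gp_least:
  fixes \<kappa> :: "'a rel"
  assumes "Card_order \<kappa>" "gp_property \<kappa>"
  shows "gp \<le>o \<kappa>"
proof (rule ccontr)
  assume "\<not> gp \<le>o \<kappa>"
  then have "\<kappa> <o gp"
    using not_ordLeq_iff_ordLess[OF card_order_on_well_order_on card_order_on_well_order_on]
      assms(1) gp_spec by blast
  then have "|Field \<kappa>| \<le>o |Field gp|"
    using card_of_mono2 ordLess_imp_ordLeq by blast
  then obtain h where h: "inj_on h (Field \<kappa>)" "h ` Field \<kappa> \<subseteq> Field gp"
    by (meson card_of_ordLeq)
  have "|Field \<kappa>| =o |h ` Field \<kappa>|"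
    using h(1) card_of_ordIso inj_on_imp_bij_betw by blast
  then have iso: "\<kappa> =o |h ` Field \<kappa>|"
    using assms(1) card_of_Field_ordIso ordIso_symmetric ordIso_transitive by blast
  then have "gp_property |h ` Field \<kappa>|"
    using gp_property_mono[OF assms(1) card_of_Card_order _ assms(2)] ordIso_iff_ordLeq by blast
  then have "gp \<le>o |h ` Field \<kappa>|"
    using gp_spec card_of_Card_order by blast
  then have "gp \<le>o \<kappa>"
    using iso ordIso_symmetric ordLeq_ordIso_trans by blast
  with \<open>\<not> gp \<le>o \<kappa>\<close> show False ..
qed

end

theory Submission
  imports Defs
begin

text \<open>
  Suppose \<open>gp = \<nu>\<close>.  Every \<open>\<mu>\<^sub>n\<close> is below \<open>gp\<close>, so there are families of \<open>\<mu>\<^sub>n\<close> clubs no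
  \<open>\<omega>\<^sub>1\<close> of which have a club intersection; by the pigeonhole principle these amalgamate into one
  such family \<open>(D\<^sub>\<gamma> : \<gamma> < \<mu>)\<close>.  The clubs \<open>\<Inter>\<^sub>n D\<^bsub>f\<^sub>\<alpha>(n)\<^esub>\<close> for \<open>\<alpha> < \<nu>\<^sup>+ \<le> \<lambda>\<close> then
  contradict \<open>gp \<le> \<nu>\<close>: if \<open>\<omega>\<^sub>1\<close> of them had a club intersection, so would the corresponding
  \<open>D\<^sub>\<gamma>\<close>, of which there are \<open>\<aleph>\<^sub>1\<close> by the last hypothesis.
\<close>

section \<open>Intersections of clubs\<close>

text \<open>A limit point of the intersection is a limit point of every \<open>C i\<close>, so
  closedness survives any intersection and only unboundedness can fail. The cofinal set
  \<open>E\<close> supplies the latter; below it is a smaller intersection already known to be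
  club.\<close>

lemma club_INTER_superset:
  assumes "I \<noteq> {}" "\<And>i. i \<in> I \<Longrightarrow> club r (C i)" "cofinal E r" "E \<subseteq> (\<Inter>i\<in>I. C i)"
  shows "club r (\<Inter>i\<in>I. C i)"
  unfolding club_def
proof (intro conjI ballI impI)
  show "(\<Inter>i\<in>I. C i) \<subseteq> Field r"
    using assms(1,2) unfolding club_def by blast
  show "cofinal (\<Inter>i\<in>I. C i) r"
    using assms(3,4) unfolding cofinal_def by (meson subsetD)
  fix \<delta>
  assume \<delta>: "\<delta> \<in> Field r" and lim: "underS r \<delta> \<noteq> {} \<and>
    (\<forall>\<beta>\<in>underS r \<delta>. \<exists>\<gamma>\<in>(\<Inter>i\<in>I. C i) \<inter> underS r \<delta>. \<beta> \<noteq> \<gamma> \<and> (\<beta>, \<gamma>) \<in> r)"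
  show "\<delta> \<in> (\<Inter>i\<in>I. C i)"
  proof
    fix i assume i: "i \<in> I"
    have "\<forall>\<beta>\<in>underS r \<delta>. \<exists>\<gamma>\<in>C i \<inter> underS r \<delta>. \<beta> \<noteq> \<gamma> \<and> (\<beta>, \<gamma>) \<in> r"
      using lim i by blast
    with lim \<delta> assms(2)[OF i] show "\<delta> \<in> C i"
      unfolding club_def by blast
  qed
qed

lemma regularCard_bound:
  assumes "Card_order r" "regularCard r" "K \<subseteq> Field r" "|K| <o r"
  shows "\<exists>b \<in> Field r. \<forall>x \<in> K. (x, b) \<in> r"
proof -
  have "\<not> cofinal K r"
    using assms(2-4) not_ordLess_ordIso unfolding regularCard_def by blast
  then obtain b where b: "b \<in> Field r" "\<forall>x \<in> K. b = x \<or> (b, x) \<notin> r"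
    unfolding cofinal_def by blast
  interpret wo_rel r
    using assms(1) by (simp add: wo_rel_def card_order_on_well_order_on)
  have "(x, b) \<in> r" if "x \<in> K" for x
    using that b assms(3) TOTALS by (metis subsetD)
  with b(1) show ?thesis by blast
qed

text \<open>Iterating a step that passes a point of every \<open>C n\<close> gives an
  \<omega>-sequence whose supremum, which exists by regularity and uncountability of
  \<open>r\<close>, is a limit point of all the \<open>C n\<close> at once.\<close>

lemma club_INTER_countable:
  fixes C :: "nat \<Rightarrow> 'a set"
  assumes r: "Card_order r" "regularCard r" "natLeq <o r" and C: "\<And>n. club r (C n)"
  shows "club r (\<Inter>n. C n)"
proof (rule club_INTER_superset[OF UNIV_not_empty C _ order_refl])
  interpret wo_rel r
    using r(1) by (simp add: wo_rel_def card_order_on_well_order_on)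
  have le: "(x, y) \<in> r" if "(y, x) \<notin> r" "x \<in> Field r" "y \<in> Field r" for x y
    using that TOTALS by blast
  have bound: "\<exists>b \<in> Field r. \<forall>n. (x n, b) \<in> r" if "\<And>n. x n \<in> Field r" for x :: "nat \<Rightarrow> 'a"
  proof -
    have "|range x| \<le>o natLeq"
      using card_of_image[of x UNIV] card_of_nat ordLeq_ordIso_trans by blast
    then have "|range x| <o r"
      using r(3) ordLeq_ordLess_trans by blast
    with that show ?thesis
      using regularCard_bound[OF r(1,2), of "range x"] by blast
  qed
  \<comment> \<open>Pick a point of each \<open>C n\<close> above \<open>x\<close>; \<open>y\<close>
    bounds these countably many points.\<close>
  have "\<exists>y \<in> Field r. \<forall>n. \<exists>c \<in> C n. x \<noteq> c \<and> (x, c) \<in> r \<and> (c, y) \<in> r" if x: "x \<in> Field r" for x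
  proof -
    have "\<forall>n. \<exists>c. c \<in> C n \<and> x \<noteq> c \<and> (x, c) \<in> r"
      using C x unfolding club_def cofinal_def by blast
    then obtain c where c: "\<And>n. c n \<in> C n \<and> x \<noteq> c n \<and> (x, c n) \<in> r"
      by metis
    moreover have "c n \<in> Field r" for n
      using c by (meson FieldI2)
    ultimately show ?thesis
      using bound[of c] by blast
  qed
  then obtain g where g: "\<And>x. x \<in> Field r \<Longrightarrow> g x \<in> Field r"
      "\<And>x n. x \<in> Field r \<Longrightarrow> \<exists>c \<in> C n. x \<noteq> c \<and> (x, c) \<in> r \<and> (c, g x) \<in> r"
    by metis
  show "cofinal (\<Inter>n. C n) r"
    unfolding cofinal_def
  proof
    fix \<beta> assume \<beta>: "\<beta> \<in> Field r"
    define x where "x k = (g ^^ k) \<beta>" for k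
    have x: "x k \<in> Field r" for k
      by (induction k) (use \<beta> g(1) in \<open>auto simp: x_def\<close>)
    define U where "U = {b \<in> Field r. \<forall>k. (x k, b) \<in> r}"
    \<comment> \<open>The supremum of the sequence, as the least of its upper bounds.\<close>
    define \<delta> where "\<delta> = minim U"
    have U: "U \<subseteq> Field r" "U \<noteq> {}"
      using bound[of x] x by (auto simp: U_def)
    have \<delta>U: "\<delta> \<in> U"
      unfolding \<delta>_def using minim_in[OF U] .
    have \<delta>: "\<delta> \<in> Field r" "(x k, \<delta>) \<in> r" for k
      using \<delta>U by (auto simp: U_def)
    have least: "(\<delta>, b) \<in> r" if "b \<in> U" for b
      unfolding \<delta>_def using minim_least[OF U(1) that] .
    have step: "\<exists>c \<in> C n. x k \<noteq> c \<and> (x k, c) \<in> r \<and> c \<noteq> \<delta> \<and> (c, \<delta>) \<in> r" for k n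
    proof -
      obtain c where c: "c \<in> C n" "x k \<noteq> c" "(x k, c) \<in> r" "(c, x (Suc k)) \<in> r"
        using g(2)[OF x, of n k] by (auto simp: x_def)
      \<comment> \<open>\<open>d\<close> only records that the sequence grows strictly from
        \<open>x (Suc k)\<close> to the next term; the club with index \<open>0\<close> is an
        arbitrary choice. This makes \<open>x (Suc k)\<close>, and hence \<open>c\<close>, differ
        from \<delta>.\<close>
      obtain d where d: "x (Suc k) \<noteq> d" "(x (Suc k), d) \<in> r" "(d, x (Suc (Suc k))) \<in> r"
        using g(2)[OF x, of 0 "Suc k"] by (auto simp: x_def)
      have "(c, \<delta>) \<in> r"
        using c(4) \<delta>(2) TRANS unfolding trans_def by blast
      moreover have "c \<noteq> \<delta>"
      proof
        assume "c = \<delta>"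
        then have "(d, x (Suc k)) \<in> r"
          using d(3) \<delta>(2) c(4) TRANS unfolding trans_def by blast
        with d(1,2) show False
          using ANTISYM unfolding antisym_def by blast
      qed
      ultimately show ?thesis
        using c by blast
    qed
    have "\<delta> \<in> C n" for n
    proof -
      have "\<exists>\<gamma> \<in> C n \<inter> underS \<delta>. \<beta>' \<noteq> \<gamma> \<and> (\<beta>', \<gamma>) \<in> r" if \<beta>': "\<beta>' \<in> underS \<delta>" for \<beta>'
      proof -
        have b: "\<beta>' \<in> Field r" "\<beta>' \<noteq> \<delta>" "(\<beta>', \<delta>) \<in> r"
          using \<beta>' by (auto simp: underS_def Field_def)
        then have "(\<delta>, \<beta>') \<notin> r"
          using ANTISYM unfolding antisym_def by blast
        \<comment> \<open>By minimality of \<delta>, the smaller \<open>\<beta>'\<close> is not an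
          upper bound of the sequence.\<close>
        then obtain k where "(x k, \<beta>') \<notin> r"
          using least b(1) by (auto simp: U_def)
        then have k: "(\<beta>', x k) \<in> r"
          using le b(1) x by blast
        obtain c where c: "c \<in> C n" "x k \<noteq> c" "(x k, c) \<in> r" "c \<noteq> \<delta>" "(c, \<delta>) \<in> r"
          using step by blast
        have "(\<beta>', c) \<in> r"
          using k c(3) TRANS unfolding trans_def by blast
        moreover have "\<beta>' \<noteq> c"
          using k c(2,3) ANTISYM unfolding antisym_def by blast
        ultimately show ?thesis
          using c by (auto simp: underS_def)
      qed
      moreover have "underS \<delta> \<noteq> {}"
        using step[of 0] by (auto simp: underS_def)
      ultimately show ?thesis
        using C[of n] \<delta>(1) unfolding club_def by blast
    qed
    moreover have "\<beta> \<noteq> \<delta> \<and> (\<beta>, \<delta>) \<in> r"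
    proof -
      obtain c where "x 0 \<noteq> c" "(x 0, c) \<in> r" "c \<noteq> \<delta>" "(c, \<delta>) \<in> r"
        using step by blast
      moreover have "x 0 = \<beta>"
        by (simp add: x_def)
      ultimately show ?thesis
        using ANTISYM \<delta>(2)[of 0] unfolding antisym_def by metis
    qed
    ultimately show "\<exists>b \<in> \<Inter>n. C n. \<beta> \<noteq> b \<and> (\<beta>, b) \<in> r"
      by blast
  qed
qed

section \<open>Families indexed by \<omega>1\<close>

lemma omega1_Card_order: "Card_order omega1"
  by (intro cardSuc_Card_order natLeq_Card_order)

lemma club_omega1_INTER_countable:
  fixes C :: "nat \<Rightarrow> nat set set"
  assumes "\<And>n. club omega1 (C n)"
  shows "club omega1 (\<Inter>n. C n)"
  using assms
  by (intro club_INTER_countable omega1_Card_order regularCard_cardSuc natLeq_Cinfinite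
      cardSuc_greater natLeq_Card_order)

text \<open>If every fibre of \<open>k\<close> were countable, \<open>G\<close> would be a countable
  union of countable sets.\<close>

lemma omega1_pigeonhole:
  fixes k :: "'a \<Rightarrow> nat"
  assumes "omega1 \<le>o |G|"
  shows "\<exists>n. omega1 \<le>o |{x \<in> G. k x = n}|"
proof (rule ccontr)
  assume no: "\<nexists>n. omega1 \<le>o |{x \<in> G. k x = n}|"
  have small: "\<forall>n \<in> UNIV. |{x \<in> G. k x = n}| \<le>o |UNIV :: nat set|"
  proof
    fix n
    have "\<not> natLeq <o |{x \<in> G. k x = n}|"
      using no cardSuc_least[OF natLeq_Card_order card_of_Card_order] by blast
    then have "|{x \<in> G. k x = n}| \<le>o natLeq"
      by (simp add: not_ordLess_iff_ordLeq natLeq_Well_order card_of_Well_order)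
    then show "|{x \<in> G. k x = n}| \<le>o |UNIV :: nat set|"
      using card_of_nat ordIso_symmetric ordLeq_ordIso_trans by blast
  qed
  have "|\<Union>n. {x \<in> G. k x = n}| \<le>o |UNIV :: nat set|"
    by (rule card_of_UNION_ordLeq_infinite[OF infinite_UNIV_nat _ small])
      (simp add: card_of_refl ordIso_imp_ordLeq)
  moreover have "(\<Union>n. {x \<in> G. k x = n}) = G"
    by auto
  ultimately have "|G| \<le>o natLeq"
    using card_of_nat ordLeq_ordIso_trans by metis
  then have "omega1 \<le>o natLeq"
    using assms ordLeq_transitive by blast
  then show False
    using not_ordLess_ordLeq cardSuc_greater[OF natLeq_Card_order] by blast
qed

lemma omega1_family_of_large_set:
  assumes "omega1 \<le>o |G|"
  shows "\<exists>b. inj_on b (Field omega1) \<and> b ` Field omega1 \<subseteq> G"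
proof -
  have "|Field omega1| =o omega1"
    by (rule card_of_Field_ordIso[OF omega1_Card_order])
  then have "|Field omega1| \<le>o |G|"
    using assms ordIso_ordLeq_trans by blast
  then show ?thesis
    using card_of_ordLeq by blast
qed

text \<open>A family of \<open>\<kappa>\<^sup>+\<close> clubs witnessing \<open>\<kappa> < gp\<close> is cut down to \<open>\<kappa>\<close> of its members.\<close>

lemma below_gp_club_family:
  fixes \<kappa> :: "'a rel"
  assumes "Card_order \<kappa>" "\<kappa> <o gp"
  shows "\<exists>C :: 'a \<Rightarrow> nat set set. (\<forall>\<gamma> \<in> Field \<kappa>. club omega1 (C \<gamma>)) \<and>
    (\<forall>b. inj_on b (Field omega1) \<and> b ` Field omega1 \<subseteq> Field \<kappa> \<longrightarrow>
      \<not> club omega1 (\<Inter>\<beta> \<in> Field omega1. C (b \<beta>)))"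
proof -
  have "\<not> gp_property \<kappa>"
    using gp_least[OF assms(1)] assms(2) not_ordLess_ordLeq by blast
  then obtain C where C: "\<forall>\<alpha> \<in> Field (cardSuc \<kappa>). club omega1 (C \<alpha>)"
    and bad: "\<And>a. inj_on a (Field omega1) \<Longrightarrow> a ` Field omega1 \<subseteq> Field (cardSuc \<kappa>) \<Longrightarrow>
      \<not> club omega1 (\<Inter>\<beta> \<in> Field omega1. C (a \<beta>))"
    unfolding gp_property_def by blast
  have "|Field \<kappa>| \<le>o |Field (cardSuc \<kappa>)|"
    using cardSuc_ordLeq[OF assms(1)] by (rule card_of_mono2)
  then obtain h where h: "inj_on h (Field \<kappa>)" "h ` Field \<kappa> \<subseteq> Field (cardSuc \<kappa>)"
    using card_of_ordLeq by metis
  \<comment> \<open>Composing with the injection \<open>h\<close> turns \<omega>1 distinct indices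
    in \<open>Field \<kappa>\<close> into distinct indices of the original bad family.\<close>
  have "\<not> club omega1 (\<Inter>\<beta> \<in> Field omega1. (C \<circ> h) (b \<beta>))"
    if "inj_on b (Field omega1)" "b ` Field omega1 \<subseteq> Field \<kappa>" for b
  proof -
    have "inj_on (h \<circ> b) (Field omega1)"
      using that h(1) by (meson comp_inj_on inj_on_subset)
    moreover have "(h \<circ> b) ` Field omega1 \<subseteq> Field (cardSuc \<kappa>)"
      using that(2) h(2) by fastforce
    ultimately show ?thesis
      using bad by fastforce
  qed
  moreover have "\<forall>\<gamma> \<in> Field \<kappa>. club omega1 ((C \<circ> h) \<gamma>)"
    using C h(2) by auto
  ultimately show ?thesis by blast
qed

section \<open>Amalgamation along the scale\<close>

theorem theorem3p6:
  fixes \<mu> :: "'m rel" and \<mu>s :: "nat \<Rightarrow> 'm rel" and J :: "nat set set"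
    and lam :: "'l rel" and f :: "'l \<Rightarrow> nat \<Rightarrow> 'm" and \<nu> :: "'n rel"
  assumes a: "Card_order \<mu>" "has_cofinality \<mu> natLeq" "natLeq <o \<mu>" "\<mu> <o ctwo ^c natLeq"
    and b: "\<And>n. Cinfinite (\<mu>s n) \<and> regularCard (\<mu>s n)"
      "\<And>n. (\<mu>s n, \<mu>) \<in> init_seg_of" "\<mu> = (\<Union>n. \<mu>s n)"
      "ideal_on_nat J" "\<And>X. bdd_above X \<Longrightarrow> X \<in> J"
    and c: "tcf_witnessed_by \<mu>s J lam f"
    and d: "Card_order \<nu>" "\<mu> \<le>o \<nu>" "\<nu> <o lam"
    and e: "\<And>A. A \<subseteq> Field lam \<Longrightarrow> |A| =o omega1 \<Longrightarrow>
      |{f \<alpha> n | \<alpha> n. \<alpha> \<in> A}| =o omega1"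
  shows "\<not> gp =o \<nu>"
proof
  assume gp: "gp =o \<nu>"
  have Card: "Card_order (\<mu>s n)" for n
    using b(1) by blast
  have below: "\<mu>s n <o gp" for n
  proof -
    have sub: "Field (\<mu>s n) \<subseteq> Field \<mu>"
      using b(3) unfolding Field_def by blast
    have "|Field (\<mu>s n)| \<le>o |Field \<mu>|"
      using sub by (rule card_of_mono1)
    then have le: "\<mu>s n \<le>o \<mu>"
      using card_of_Field_ordIso[OF Card, of n] card_of_Field_ordIso[OF a(1)]
      by (meson ordIso_ordLeq_trans ordIso_symmetric ordLeq_ordIso_trans)
    \<comment> \<open>Otherwise \<mu> would be regular with a countable cofinal set, hence
      countable.\<close>
    have "\<not> \<mu>s n =o \<mu>"
    proof
      assume iso: "\<mu>s n =o \<mu>"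
      have "regularCard \<mu>"
        using regularCard_ordIso[OF iso] b(1) by (meson)
      moreover obtain K where "K \<subseteq> Field \<mu>" "cofinal K \<mu>" "|K| =o natLeq"
        using a(2) unfolding has_cofinality_def by blast
      ultimately have "natLeq =o \<mu>"
        unfolding regularCard_def by (meson ordIso_symmetric ordIso_transitive)
      with a(3) show False
        using not_ordLess_ordIso by blast
    qed
    with le have "\<mu>s n <o \<mu>"
      using ordLeq_iff_ordLess_or_ordIso by blast
    then show ?thesis
      using d(2) gp by (meson ordIso_symmetric ordLess_ordLeq_trans ordLess_ordIso_trans)
  qed
  have "\<forall>n. \<exists>C :: 'm \<Rightarrow> nat set set. (\<forall>\<gamma> \<in> Field (\<mu>s n). club omega1 (C \<gamma>)) \<and>
    (\<forall>b. inj_on b (Field omega1) \<and> b ` Field omega1 \<subseteq> Field (\<mu>s n) \<longrightarrow>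
      \<not> club omega1 (\<Inter>\<beta> \<in> Field omega1. C (b \<beta>)))"
    using below_gp_club_family[OF Card below] by blast
  then obtain C :: "nat \<Rightarrow> 'm \<Rightarrow> nat set set"
    where C: "\<And>n \<gamma>. \<gamma> \<in> Field (\<mu>s n) \<Longrightarrow> club omega1 (C n \<gamma>)"
      and bad: "\<And>n b. inj_on b (Field omega1) \<Longrightarrow> b ` Field omega1 \<subseteq> Field (\<mu>s n) \<Longrightarrow>
        \<not> club omega1 (\<Inter>\<beta> \<in> Field omega1. C n (b \<beta>))"
    by metis
  \<comment> \<open>One \<gamma> may lie in the fields of many \<open>\<mu>s n\<close>;
    \<open>k\<close> assigns it to a single family, so that \<open>D\<close> depends on \<gamma>
    alone.\<close>
  define k where "k \<gamma> = (LEAST n. \<gamma> \<in> Field (\<mu>s n))" for \<gamma>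
  have k: "\<gamma> \<in> Field (\<mu>s (k \<gamma>))" if "\<gamma> \<in> Field (\<mu>s n)" for \<gamma> n
    unfolding k_def using that by (rule LeastI)
  define D where "D \<gamma> = C (k \<gamma>) \<gamma>" for \<gamma>
  have fF: "f \<alpha> n \<in> Field (\<mu>s n)" if "\<alpha> \<in> Field lam" for \<alpha> n
    using c that unfolding tcf_witnessed_by_def in_product_def by blast
  have E: "club omega1 (\<Inter>n. D (f \<alpha> n))" if "\<alpha> \<in> Field lam" for \<alpha>
    using club_omega1_INTER_countable[of "\<lambda>n. D (f \<alpha> n)"] C k fF[OF that] unfolding D_def by blast
  have "Card_order lam"
    using c unfolding tcf_witnessed_by_def by blast
  \<comment> \<open>From \<nu> < \<lambda> it follows that the successor of \<nu> embeds into
    \<lambda>; \<open>h\<close> thus indexes a family of clubs to which the property of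
    \<open>gp\<close>, transferred to \<nu>, applies.\<close>
  then have "cardSuc \<nu> \<le>o lam"
    using cardSuc_least d(1,3) by blast
  then have "|Field (cardSuc \<nu>)| \<le>o |Field lam|"
    by (rule card_of_mono2)
  then obtain h where h: "inj_on h (Field (cardSuc \<nu>))" "h ` Field (cardSuc \<nu>) \<subseteq> Field lam"
    using card_of_ordLeq by metis
  have "gp_property \<nu>"
    using gp_property_mono[OF _ d(1) _ , of gp] gp_spec ordIso_imp_ordLeq[OF gp] by blast
  moreover have "\<forall>\<alpha> \<in> Field (cardSuc \<nu>). club omega1 (\<Inter>n. D (f (h \<alpha>) n))"
    using E h(2) by blast
  ultimately obtain a where a: "inj_on a (Field omega1)" "a ` Field omega1 \<subseteq> Field (cardSuc \<nu>)"
      "club omega1 (\<Inter>\<beta> \<in> Field omega1. \<Inter>n. D (f (h (a \<beta>)) n))"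
    unfolding gp_property_def by (elim allE[where x="\<lambda>\<alpha>. \<Inter>n. D (f (h \<alpha>) n)"] impE) blast+
  define A where "A = h ` a ` Field omega1"
  define G where "G = {f \<alpha> n | \<alpha> n. \<alpha> \<in> A}"
  have A: "A \<subseteq> Field lam"
    using a(2) h(2) unfolding A_def by blast
  have "inj_on (h \<circ> a) (Field omega1)"
    using a(1,2) h(1) by (meson comp_inj_on inj_on_subset)
  then have "bij_betw (h \<circ> a) (Field omega1) A"
    unfolding A_def bij_betw_def by (simp add: image_comp)
  then have "|Field omega1| =o |A|"
    using card_of_ordIso by blast
  then have "|A| =o omega1"
    using card_of_Field_ordIso[OF omega1_Card_order] ordIso_symmetric ordIso_transitive by blast
  \<comment> \<open>Hypothesis \<open>e\<close>: aleph_1 many members of the scale take aleph_1 many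
    values, so the clubs selected by \<open>a\<close> involve uncountably many of the
    \<open>D \<gamma>\<close>.\<close>
  then have "omega1 \<le>o |G|"
    using e[OF A] unfolding G_def by (meson ordIso_iff_ordLeq)
  \<comment> \<open>Uncountably many of these values are assigned to the same \<open>n\<close>, and
    on them \<open>D\<close> agrees with \<open>C n\<close>.\<close>
  then obtain n where "omega1 \<le>o |{\<gamma> \<in> G. k \<gamma> = n}|"
    using omega1_pigeonhole by blast
  then obtain s where s: "inj_on s (Field omega1)" "s ` Field omega1 \<subseteq> {\<gamma> \<in> G. k \<gamma> = n}"
    using omega1_family_of_large_set by blast
  have sF: "s ` Field omega1 \<subseteq> Field (\<mu>s n)"
  proof
    fix \<gamma> assume "\<gamma> \<in> s ` Field omega1"
    then have "\<gamma> \<in> G" "k \<gamma> = n"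
      using s(2) by auto
    \<comment> \<open>The coordinate \<open>m\<close> where \<gamma> occurs may differ from
      \<open>n\<close>; membership in \<open>Field (\<mu>s n)\<close> comes from
      \<open>k \<gamma> = n\<close>.\<close>
    then obtain \<alpha> m where "\<alpha> \<in> A" "\<gamma> = f \<alpha> m"
      unfolding G_def by blast
    then have "\<gamma> \<in> Field (\<mu>s m)"
      using fF A by blast
    then show "\<gamma> \<in> Field (\<mu>s n)"
      using k \<open>k \<gamma> = n\<close> by metis
  qed
  have "club omega1 (\<Inter>\<beta> \<in> Field omega1. C n (s \<beta>))"
  proof (rule club_INTER_superset)
    show "Field omega1 \<noteq> {}"
      by (rule Field_cardSuc_not_empty[OF natLeq_Card_order])
    show "club omega1 (C n (s \<beta>))" if "\<beta> \<in> Field omega1" for \<beta>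
      using C sF that by blast
    show "cofinal (\<Inter>\<beta> \<in> Field omega1. \<Inter>n. D (f (h (a \<beta>)) n)) omega1"
      using a(3) unfolding club_def by blast
    show "(\<Inter>\<beta> \<in> Field omega1. \<Inter>n. D (f (h (a \<beta>)) n)) \<subseteq> (\<Inter>\<beta> \<in> Field omega1. C n (s \<beta>))"
    proof (rule INT_greatest)
      fix \<beta> assume "\<beta> \<in> Field omega1"
      then have "s \<beta> \<in> G" "k (s \<beta>) = n"
        using s(2) by auto
      \<comment> \<open>Each \<open>s \<beta>\<close> is a value of some selected scale member, so
        its club \<open>D (s \<beta>)\<close> already takes part in the large intersection.\<close>
      then obtain \<beta>' m where "\<beta>' \<in> Field omega1" "s \<beta> = f (h (a \<beta>')) m"
        unfolding G_def A_def by blast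
      moreover have "C n (s \<beta>) = D (s \<beta>)"
        using \<open>k (s \<beta>) = n\<close> by (simp add: D_def)
      ultimately show "(\<Inter>\<beta> \<in> Field omega1. \<Inter>n. D (f (h (a \<beta>)) n)) \<subseteq> C n (s \<beta>)"
        by auto
    qed
  qed
  with bad[OF s(1) sF] show False by blast
qed

end
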